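(* Let $p$ be a prime with $p\equiv 1 \pmod 4$, let $s$ be a non-negative integer, let $q=p^{2s+1}$, and let $N=\omega(P_q)$ be the clique number of the Paley graph $P_q$. If $n$ is an integer with $2\leq n\leq N$ such that $$\binom{n-1+\frac{q-1}{2}}{\frac{q-1}{2}}\not\equiv 0 \pmod p,$$ then $(N-1)n\leq \frac{q-1}{2}$.
   Context: For a prime power $q\equiv 1\pmod 4$, the Paley graph $P_q$ is the undirected graph whose vertices are the elements of the finite field $\mathbb{F}_q$, two vertices being adjacent if and only if their difference is a quadratic residue in $\mathbb{F}_q^*=\mathbb{F}_q\setminus\{0\}$ (i.e. a nonzero square). For an undirected graph $G$, the clique number $\omega(G)$ is the size of a maximum clique of $G$. *)

theory Defs
  imports "HOL-Library.Ramsey" "HOL-Computational_Algebra.Computational_Algebra" "HOL-Number_Theory.Cong"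
begin

(* An undirected graph is given by its vertex set V and its set E of two-element edges;
   clique is the predicate of HOL-Library.Ramsey. V is meant to be finite. *)

definition clique_number :: "'a set \<Rightarrow> 'a set set \<Rightarrow> nat" where
  "clique_number V E = Max {card C | C. C \<subseteq> V \<and> clique C E}"

definition quadratic_residue :: "'a::field \<Rightarrow> bool" where
  "quadratic_residue a \<longleftrightarrow> a \<noteq> 0 \<and> is_square a"

(* The edge set is that of an undirected graph when -1 is a square, i.e. when CARD('a) mod 4 = 1
   (for CARD('a) odd). *)
definition paley_edges :: "'a::{field,finite} set set" where
  "paley_edges = {{x, y} | x y. quadratic_residue (x - y)}"

end

theory Submission
  imports Defs
begin

text \<open>
  The proof is the polynomial method of Stepanov, in the form used by Hanson and Petridis. Let
  \<open>C\<close> be a maximum clique, \<open>S \<subseteq> C\<close> with \<open>n\<close> elements and \<open>h = (q - 1) / 2\<close>, so that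
  \<open>(x - y)\<^sup>h = 1\<close> for distinct \<open>x, y \<in> C\<close>. With \<open>a\<^sub>x\<close> the weights for which
  \<open>\<Sum>x\<in>S. a\<^sub>x g(x)\<close> is the coefficient of \<open>X\<^bsup>n-1\<^esup>\<close> in every polynomial \<open>g\<close> of degree less than \<open>n\<close>,
  put \<open>f = \<Sum>x\<in>S. a\<^sub>x (X - x)\<^bsup>n-1+h\<^esup> - (-1)\<^bsup>n-1\<^esup>\<close>. All coefficients above \<open>X\<^sup>h\<close> cancel, and that
  of \<open>X\<^sup>h\<close> is, up to sign, the given binomial coefficient; hence \<open>f\<close> has degree \<open>h\<close>. On the other
  hand, at a point of \<open>C\<close> the factor \<open>(c - x)\<^sup>h\<close> disappears from the Taylor coefficients, which
  therefore vanish to order \<open>n - 1\<close> on \<open>S\<close> and to order \<open>n\<close> on \<open>C - S\<close>. Counting zeros gives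
  \<open>n (N - n) + (n - 1) n \<le> h\<close>.
\<close>

section \<open>Lagrange weights\<close>

text \<open>For \<open>x\<close> in a finite \<open>S\<close>, the leading coefficient of the
  Lagrange basis polynomial at the node \<open>x\<close>.\<close>

definition lagrange_weight :: "'a::field set \<Rightarrow> 'a \<Rightarrow> 'a" where
  "lagrange_weight S x = inverse (\<Prod>y\<in>S - {x}. x - y)"

text \<open>\<open>g\<close> equals its Lagrange interpolant \<open>G\<close> on \<open>S\<close>,
  as both have degree below \<open>card S\<close>. Each \<open>L x\<close> is monic of degree
  \<open>card S - 1\<close>, so comparing coefficients there gives the sum.\<close>

lemma sum_lagrange_weight:
  fixes g :: "'a::field poly"
  assumes "finite S" and "degree g < card S"
  shows "(\<Sum>x\<in>S. lagrange_weight S x * poly g x) = coeff g (card S - 1)"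
proof -
  define L where "L x = (\<Prod>y\<in>S - {x}. [:-y, 1:])" for x
  define G where "G = (\<Sum>x\<in>S. smult (lagrange_weight S x * poly g x) (L x))"
  have degree_L: "degree (L x) = card S - 1" if "x \<in> S" for x
    using that assms(1) by (simp add: L_def degree_prod_eq_sum_degree)
  have coeff_L: "coeff (L x) (card S - 1) = 1" if "x \<in> S" for x
    using lead_coeff_prod[of "\<lambda>y. [:-y, 1:]" "S - {x}"] degree_L[OF that]
    by (simp add: L_def)
  have poly_L: "poly (L x) z = (if z = x then inverse (lagrange_weight S x) else 0)"
    if "z \<in> S" for x z
    using that assms(1) by (auto simp: L_def poly_prod lagrange_weight_def)
  have weight_nz: "lagrange_weight S x \<noteq> 0" for x
    using assms(1) by (simp add: lagrange_weight_def)
  have "g = G"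
  proof (rule poly_eqI_degree)
    fix z assume "z \<in> S"
    then have "poly G z = lagrange_weight S z * poly g z * inverse (lagrange_weight S z)"
      using assms(1) by (simp add: G_def poly_sum poly_L if_distrib sum.delta cong: if_cong)
    then show "poly g z = poly G z"
      using weight_nz by simp
  next
    have "degree G \<le> card S - 1"
      unfolding G_def
      by (rule degree_sum_le[OF assms(1)]) (metis degree_L degree_smult_le)
    then show "degree G < card S"
      using assms(2) by linarith
  qed (use assms(2) in auto)
  then have "coeff g (card S - 1) = coeff G (card S - 1)"
    by simp
  also have "\<dots> = (\<Sum>x\<in>S. lagrange_weight S x * poly g x)"
    by (simp add: G_def coeff_sum coeff_L del: One_nat_def)
  finally show ?thesis
    by simp
qed

lemma sum_lagrange_weight_power:
  fixes c :: "'a::field"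
  assumes "finite S" and "m < card S"
  shows "(\<Sum>x\<in>S. lagrange_weight S x * (c - x) ^ m) = (if m = card S - 1 then (-1) ^ m else 0)"
proof -
  have "(\<Sum>x\<in>S. lagrange_weight S x * poly ([:c, -1:] ^ m) x) = coeff ([:c, -1:] ^ m) (card S - 1)"
    using assms by (intro sum_lagrange_weight) simp_all
  moreover have "coeff ([:c, -1:] ^ m) (card S - 1) = 0" if "m \<noteq> card S - 1"
    using that assms(2) by (intro coeff_eq_0) simp
  ultimately show ?thesis
    by auto
qed

section \<open>Counting zeros with multiplicity\<close>

lemma pcompose_power: "pcompose (p ^ m) r = pcompose p r ^ m"
  for p r :: "'a::comm_semiring_1 poly"
  by (induction m) (simp_all only: power_0 power_Suc pcompose_mult pcompose_1)

text \<open>Translation by \<open>c\<close> is a ring automorphism with inverse translation by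
  \<open>-c\<close>, and it turns \<open>X - c\<close> into \<open>X\<close>. Taylor coefficients
  detect multiplicity in every characteristic, whereas iterated derivatives carry factors
  \<open>k!\<close> that may vanish.\<close>

lemma linear_power_dvd_iff_pcompose:
  fixes f :: "'a::comm_ring_1 poly"
  shows "[:-c, 1:] ^ m dvd f \<longleftrightarrow> (\<forall>k<m. coeff (pcompose f [:c, 1:]) k = 0)"
proof -
  have X: "monom 1 m = [:0, 1::'a:] ^ m"
    by (simp add: monom_altdef)
  have "[:-c, 1:] ^ m dvd f \<longleftrightarrow> [:0, 1:] ^ m dvd pcompose f [:c, 1:]"
  proof
    assume "[:-c, 1:] ^ m dvd f"
    then obtain g where "f = [:-c, 1:] ^ m * g" ..
    then show "[:0, 1:] ^ m dvd pcompose f [:c, 1:]"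
      by (simp add: pcompose_mult pcompose_power pcompose_pCons)
  next
    assume "[:0, 1:] ^ m dvd pcompose f [:c, 1:]"
    then obtain g where "pcompose f [:c, 1:] = [:0, 1:] ^ m * g" ..
    then have "pcompose (pcompose f [:c, 1:]) [:-c, 1:] = [:-c, 1:] ^ m * pcompose g [:-c, 1:]"
      by (simp add: pcompose_mult pcompose_power pcompose_pCons)
    then show "[:-c, 1:] ^ m dvd f"
      by (simp flip: pcompose_assoc add: pcompose_pCons)
  qed
  then show ?thesis
    by (simp add: monom_1_dvd_iff' flip: X)
qed

lemma sum_order_le_degree:
  fixes f :: "'a::idom poly"
  assumes "f \<noteq> 0" and "finite C"
  shows "(\<Sum>c\<in>C. order c f) \<le> degree f"
proof -
  have fin: "finite {x. poly f x = 0}"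
    using assms(1) by (rule poly_roots_finite)
  have "(\<Sum>c\<in>C. order c f) = (\<Sum>c\<in>C \<inter> {x. poly f x = 0}. order c f)"
    using assms by (intro sum.mono_neutral_right) (auto simp: order_root)
  also have "\<dots> \<le> (\<Sum>c | poly f c = 0. order c f)"
    using fin by (intro sum_mono2) auto
  also have "\<dots> = size (proots f)"
    using assms(1) by (simp add: size_multiset_overloaded_eq)
  also have "\<dots> \<le> degree f"
    by (rule size_proots_le)
  finally show ?thesis .
qed

section \<open>The Stepanov polynomial\<close>

lemma coeff_pcompose_sum_shifted_powers:
  fixes a :: "'a::comm_ring_1 \<Rightarrow> 'a"
  shows "coeff (pcompose (\<Sum>x\<in>S. smult (a x) ([:-x, 1:] ^ m)) [:c, 1:]) k
       = of_nat (m choose k) * (\<Sum>x\<in>S. a x * (c - x) ^ (m - k))"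
proof -
  have pow: "pcompose ([:-x, 1:] ^ m) [:c, 1:] = [:c - x, 1:] ^ m" for x
    by (simp add: pcompose_power pcompose_pCons)
  have "coeff ([:b, 1:] ^ m) k = of_nat (m choose k) * b ^ (m - k)" for b :: 'a
  proof (cases "k \<le> m")
    case True
    then show ?thesis
      by (simp add: coeff_linear_poly_power)
  next
    case False
    then have "degree ([:b, 1:] ^ m) < k"
      using degree_power_le[of "[:b, 1:]" m] by simp
    then show ?thesis
      using False by (simp add: coeff_eq_0 binomial_eq_0)
  qed
  then show ?thesis
    by (simp add: pcompose_sum pcompose_smult pow coeff_sum sum_distrib_left mult_ac)
qed

theorem stepanov_clique_bound:
  fixes C :: "'a::field set"
  assumes "finite C" and "2 \<le> n" and "n \<le> card C" and "0 < h"
    and power_diff: "\<And>x y. x \<in> C \<Longrightarrow> y \<in> C \<Longrightarrow> x \<noteq> y \<Longrightarrow> (x - y) ^ h = 1"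
    and binomial: "of_nat ((n - 1 + h) choose h) \<noteq> (0 :: 'a)"
  shows "(card C - 1) * n \<le> h"
proof -
  obtain S where S: "S \<subseteq> C" "card S = n" "finite S"
    using obtain_subset_with_card_n[OF \<open>n \<le> card C\<close>] by metis
  define w where "w = lagrange_weight S"
  define f where "f = (\<Sum>x\<in>S. smult (w x) ([:-x, 1:] ^ (n - 1 + h))) - [:(-1) ^ (n - 1):]"
  have taylor: "coeff (pcompose f [:c, 1:]) k =
      of_nat ((n - 1 + h) choose k) * (\<Sum>x\<in>S. w x * (c - x) ^ (n - 1 + h - k))
      - (if k = 0 then (-1) ^ (n - 1) else 0)" for c k
    by (simp add: f_def pcompose_diff coeff_pcompose_sum_shifted_powers coeff_pCons
        split: nat.split)
  have weights: "(\<Sum>x\<in>S. w x * (c - x) ^ m) = (if m = n - 1 then (-1) ^ m else 0)"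
    if "m < n" for c m
    using sum_lagrange_weight_power[of S m c] S that by (simp add: w_def)

  have coeff_f: "coeff f k =
      of_nat ((n - 1 + h) choose k) * (\<Sum>x\<in>S. w x * (0 - x) ^ (n - 1 + h - k))" if "0 < k" for k
    using taylor[of 0 k] that by simp
  \<comment> \<open>At \<open>k = h\<close> the remaining exponent is \<open>n - 1\<close>, so the
    weighted sum is \<open>(-1) ^ (n - 1)\<close>.\<close>
  have "coeff f h \<noteq> 0"
    using binomial weights[of "n - 1" 0] \<open>0 < h\<close> \<open>2 \<le> n\<close> by (simp add: coeff_f)
  then have "f \<noteq> 0"
    by auto
  have "coeff f k = 0" if "h < k" for k
  proof (cases "k \<le> n - 1 + h")
    case True
    then have "n - 1 + h - k < n - 1"
      using that by linarith
    with that show ?thesis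
      using weights[of "n - 1 + h - k" 0] by (simp add: coeff_f)
  qed (use that in \<open>simp add: coeff_f binomial_eq_0\<close>)
  then have "degree f \<le> h"
    by (intro degree_le) simp

  have low: "coeff (pcompose f [:c, 1:]) k = 0" if "c \<in> C" "k < n - 1" for c k
  proof -
    \<comment> \<open>For \<open>x = c\<close> both sides are 0, because \<open>k < n - 1\<close>
      keeps both exponents positive.\<close>
    have "(c - x) ^ (n - 1 + h - k) = (c - x) ^ (n - 1 - k)" if "x \<in> S" for x
    proof (cases "x = c")
      case False
      have "n - 1 + h - k = (n - 1 - k) + h"
        using \<open>k < n - 1\<close> by linarith
      then show ?thesis
        using power_diff[of c x] False \<open>c \<in> C\<close> \<open>x \<in> S\<close> S(1) by (auto simp: power_add)
    qed (use \<open>k < n - 1\<close> in \<open>simp add: power_0_left\<close>)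
    then have "(\<Sum>x\<in>S. w x * (c - x) ^ (n - 1 + h - k)) = (\<Sum>x\<in>S. w x * (c - x) ^ (n - 1 - k))"
      by simp
    \<comment> \<open>For \<open>k = 0\<close> the weighted sum is \<open>(-1) ^ (n - 1)\<close>,
      which the constant subtracted in \<open>f\<close> cancels; for larger \<open>k\<close> it is
      0.\<close>
    then show ?thesis
      using weights[of "n - 1 - k" c] that by (auto simp: taylor)
  qed
  \<comment> \<open>The exponent left is exactly \<open>h\<close>. For \<open>c\<close> in
    \<open>S\<close> the term \<open>x = c\<close> would be 0 instead of \<open>w c\<close>, hence
    the restriction to \<open>C - S\<close>.\<close>
  have top: "coeff (pcompose f [:c, 1:]) (n - 1) = 0" if "c \<in> C - S" for c
  proof -
    have "(c - x) ^ h = 1" if "x \<in> S" for x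
      using power_diff[of c x] \<open>c \<in> C - S\<close> that S(1) by auto
    then have "(\<Sum>x\<in>S. w x * (c - x) ^ h) = (\<Sum>x\<in>S. w x * (c - x) ^ 0)"
      by simp
    also have "\<dots> = 0"
      using \<open>2 \<le> n\<close> by (subst weights) auto
    finally show ?thesis
      using \<open>2 \<le> n\<close> by (simp add: taylor)
  qed
  have order_S: "n - 1 \<le> order c f" if "c \<in> S" for c
  proof -
    have "[:-c, 1:] ^ (n - 1) dvd f"
      using low that S(1) by (auto simp: linear_power_dvd_iff_pcompose)
    then show ?thesis
      using \<open>f \<noteq> 0\<close> by (simp add: order_divides)
  qed
  have order_C: "n \<le> order c f" if "c \<in> C - S" for c
  proof -
    have "coeff (pcompose f [:c, 1:]) k = 0" if "k < n" for k
      using low[of c k] top[of c] \<open>c \<in> C - S\<close> that by (cases "k = n - 1") auto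
    then have "[:-c, 1:] ^ n dvd f"
      by (simp add: linear_power_dvd_iff_pcompose)
    then show ?thesis
      using \<open>f \<noteq> 0\<close> by (simp add: order_divides)
  qed

  have "(card C - 1) * n = (\<Sum>c\<in>S. n - 1) + (\<Sum>c\<in>C - S. n)"
    using S \<open>n \<le> card C\<close> \<open>2 \<le> n\<close> by (simp add: card_Diff_subset algebra_simps)
  also have "\<dots> \<le> (\<Sum>c\<in>S. order c f) + (\<Sum>c\<in>C - S. order c f)"
    by (intro add_mono sum_mono order_S order_C)
  also have "\<dots> = (\<Sum>c\<in>C. order c f)"
    using sum.subset_diff[OF S(1) \<open>finite C\<close>, of "\<lambda>c. order c f"] by simp
  also have "\<dots> \<le> h"
    using sum_order_le_degree[OF \<open>f \<noteq> 0\<close> \<open>finite C\<close>] \<open>degree f \<le> h\<close> by linarith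
  finally show ?thesis .
qed

section \<open>Cliques in Paley graphs\<close>

text \<open>Translation by 1 permutes the ring, so it leaves the sum of all elements
  unchanged.\<close>

lemma of_nat_card_UNIV_eq_0: "of_nat (card (UNIV :: 'a set)) = (0 :: 'a::{ring_1,finite})"
proof -
  have "(\<Sum>x\<in>UNIV. x) = (\<Sum>x\<in>UNIV. x + 1 :: 'a)"
    by (rule sum.reindex_bij_witness[of _ "\<lambda>x. x + 1" "\<lambda>x. x - 1"]) auto
  then show ?thesis
    by (simp add: sum.distrib)
qed

lemma CHAR_eq_prime:
  assumes "prime p" and "card (UNIV :: 'a::{field,finite} set) = p ^ k"
  shows "CHAR('a) = p"
proof -
  have "CHAR('a) dvd p ^ k"
    using of_nat_card_UNIV_eq_0[where 'a = 'a] assms(2) by (simp only: of_nat_eq_0_iff_char_dvd)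
  moreover have "prime CHAR('a)"
    using finite_imp_CHAR_pos[where 'a = 'a] by (intro prime_CHAR_semidom) simp
  ultimately show ?thesis
    using assms(1) by (meson prime_dvd_power primes_dvd_imp_eq)
qed

text \<open>The library states this for the class \<open>finite_field\<close>, which the sort \<open>{field, finite}\<close> does not entail.\<close>
lemma field_power_card_minus_1:
  fixes x :: "'a::{field,finite}"
  assumes "x \<noteq> 0"
  shows "x ^ (card (UNIV :: 'a set) - 1) = 1"
proof -
  have "x ^ (card (UNIV :: 'a set) - 1) * \<Prod>(UNIV - {0}) = (\<Prod>y\<in>UNIV - {0}. x * y)"
    by (simp add: prod.distrib)
  also have "\<dots> = \<Prod>(UNIV - {0})"
    by (rule prod.reindex_bij_witness[of _ "\<lambda>y. y / x" "\<lambda>y. x * y"]) (use assms in auto)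
  finally show ?thesis
    by simp
qed

lemma quadratic_residue_power_half:
  fixes a :: "'a::{field,finite}"
  assumes "quadratic_residue a" and "odd (card (UNIV :: 'a set))"
  shows "a ^ ((card (UNIV :: 'a set) - 1) div 2) = 1"
proof -
  obtain b where b: "a = b ^ 2" "b \<noteq> 0"
    using assms(1) by (auto simp: quadratic_residue_def is_nth_power_def)
  have "a ^ ((card (UNIV :: 'a set) - 1) div 2) = b ^ (card (UNIV :: 'a set) - 1)"
    using assms(2) by (simp add: b(1) flip: power_mult)
  then show ?thesis
    using field_power_card_minus_1[OF b(2)] by simp
qed

lemma clique_paley_power_diff:
  fixes C :: "'a::{field,finite} set"
  assumes "clique C paley_edges" and "card (UNIV :: 'a set) mod 4 = 1"
    and "x \<in> C" and "y \<in> C" and "x \<noteq> y"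
  shows "(x - y) ^ ((card (UNIV :: 'a set) - 1) div 2) = 1"
proof -
  have "even ((card (UNIV :: 'a set) - 1) div 2)" and odd: "odd (card (UNIV :: 'a set))"
    using assms(2) by presburger+
  \<comment> \<open>An unordered edge does not tell which difference is the residue; the even
    exponent makes the sign irrelevant.\<close>
  moreover from assms have "quadratic_residue (x - y) \<or> quadratic_residue (y - x)"
    by (auto simp: clique_def paley_edges_def doubleton_eq_iff)
  ultimately show ?thesis
    by (metis quadratic_residue_power_half power_minus_even minus_diff_eq)
qed

lemma clique_number_attained:
  assumes "finite V"
  obtains C where "C \<subseteq> V" and "clique C E" and "card C = clique_number V E"
proof -
  let ?K = "{card C | C. C \<subseteq> V \<and> clique C E}"
  have "?K \<subseteq> card ` Pow V"
    by auto
  then have "finite ?K"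
    using assms by (auto intro: finite_subset)
  \<comment> \<open>The empty clique ensures that the maximum is over a nonempty set.\<close>
  moreover have "card {} \<in> ?K"
    by (force simp: clique_def)
  ultimately have "Max ?K \<in> ?K"
    by (intro Max_in) auto
  then show ?thesis
    using that by (auto simp: clique_number_def)
qed

theorem theorem1p6:
  fixes p s q n N :: nat
  assumes "prime p" and "p mod 4 = 1"
    and "q = p ^ (2 * s + 1)"
    and "card (UNIV :: 'a::{field,finite} set) = q"
    and "N = clique_number (UNIV :: 'a set) paley_edges"
    and "2 \<le> n" and "n \<le> N"
    and "\<not> [(n - 1 + (q - 1) div 2) choose ((q - 1) div 2) = 0] (mod p)"
  shows "(N - 1) * n \<le> (q - 1) div 2"
proof -
  obtain C :: "'a set" where C: "clique C paley_edges" "card C = N"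
    using clique_number_attained[of "UNIV :: 'a set"] assms(5) by (metis finite)
  have "q mod 4 = 1"
    by (metis assms(2,3) mod_mod_trivial power_mod power_one)
  moreover have "1 < q"
    unfolding assms(3) using prime_gt_1_nat[OF assms(1)] by (rule one_less_power) simp
  ultimately have "0 < (q - 1) div 2"
    by presburger
  \<comment> \<open>The field has characteristic \<open>p\<close>, so being nonzero mod
    \<open>p\<close> means being nonzero in the field.\<close>
  moreover have "of_nat ((n - 1 + (q - 1) div 2) choose ((q - 1) div 2)) \<noteq> (0 :: 'a)"
    using CHAR_eq_prime[OF assms(1) assms(4)[unfolded assms(3)]] assms(8)
    by (simp add: of_nat_eq_0_iff_char_dvd cong_0_iff)
  moreover have "(x - y) ^ ((q - 1) div 2) = 1" if "x \<in> C" "y \<in> C" "x \<noteq> y" for x y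
    using clique_paley_power_diff[OF C(1) _ that] assms(4) \<open>q mod 4 = 1\<close> by simp
  ultimately show ?thesis
    using stepanov_clique_bound[of C n "(q - 1) div 2"] C(2) assms(6,7) by simp
qed

end
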